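(* Let $Q$ be a near prequantale and $a \in Q$, and let $v(a)$ be the largest nucleus $\star$ on $Q$ such that $a^\star = a$ (which exists). Then one has $$x^{v(a)} = \bigvee\{y \in Q : \forall f \in \operatorname{Lin}(Q)\ (f(x) \leq a \Rightarrow f(y) \leq a)\}$$ for all $x \in Q$; alternatively, $x^{v(a)}$ is the largest element of $Q$ such that $f(x) \leq a$ implies $f(x^{v(a)}) \leq a$ for all $f \in \operatorname{Lin}(Q)$.
   Context: An ordered magma is a set with a binary operation (written multiplicatively) and a partial order such that $x\le x'$, $y \le y'$ imply $xy \le x'y'$. A near prequantale is an ordered magma $Q$ such that $\bigvee X$ exists and $a(\bigvee X) = \bigvee(aX)$, $(\bigvee X)a = \bigvee(Xa)$ for every $a \in Q$ and every nonempty $X\subseteq Q$. A closure operation on a poset is a self-map $\star: x\mapsto x^\star$ that is expansive, order-preserving and idempotent; a nucleus on an ordered magma $M$ is a closure operation $\star$ with $x^\star y^\star \le (xy)^\star$ for all $x,y\in M$. Nuclei are ordered pointwise. For a magma $M$ and $r\in M$, the translations $L_r,R_r$ are the self-maps $L_r(x)=rx$, $R_r(x)=xr$ of $M$; $\operatorname{Lin}(M)$ is the submonoid (containing the identity map) of the monoid of all self-maps of $M$ under composition generated by all translations. *)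

theory Defs
  imports Main
begin

class ordered_magma = order + times +
  assumes magma_mult_mono: "x \<le> x' \<Longrightarrow> y \<le> y' \<Longrightarrow> x * y \<le> x' * y'"

text \<open>
  The assumptions determine \<^term>\<open>Sup X\<close> uniquely as the least upper bound of any nonempty
  set \<^term>\<open>X\<close>; nothing is assumed about \<^term>\<open>Sup {}\<close>, so its value carries no information.
\<close>

class near_prequantale = ordered_magma + Sup +
  assumes nonempty_Sup_upper: "x \<in> X \<Longrightarrow> x \<le> Sup X"
    and nonempty_Sup_least: "X \<noteq> {} \<Longrightarrow> (\<And>x. x \<in> X \<Longrightarrow> x \<le> z) \<Longrightarrow> Sup X \<le> z"
    and mult_nonempty_Sup: "X \<noteq> {} \<Longrightarrow> a * Sup X = Sup ((\<lambda>x. a * x) ` X)"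
    and nonempty_Sup_mult: "X \<noteq> {} \<Longrightarrow> Sup X * a = Sup ((\<lambda>x. x * a) ` X)"

definition closure_operation :: "('a::order \<Rightarrow> 'a) \<Rightarrow> bool" where
  "closure_operation c \<longleftrightarrow> (\<forall>x. x \<le> c x) \<and> mono c \<and> (\<forall>x. c (c x) = c x)"

definition nucleus :: "('a::ordered_magma \<Rightarrow> 'a) \<Rightarrow> bool" where
  "nucleus c \<longleftrightarrow> closure_operation c \<and> (\<forall>x y. c x * c y \<le> c (x * y))"

text \<open>The order in \<open>GREATEST\<close> is the pointwise one of the function type.\<close>

definition nucleus_v :: "'a::ordered_magma \<Rightarrow> 'a \<Rightarrow> 'a" where
  "nucleus_v a = (GREATEST c. nucleus c \<and> c a = a)"

definition left_translation :: "'a::times \<Rightarrow> 'a \<Rightarrow> 'a" where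
  "left_translation r x = r * x"

definition right_translation :: "'a::times \<Rightarrow> 'a \<Rightarrow> 'a" where
  "right_translation r x = x * r"

inductive_set Lin :: "('a::times \<Rightarrow> 'a) set" where
  Lin_id: "id \<in> Lin"
| Lin_left: "left_translation r \<in> Lin"
| Lin_right: "right_translation r \<in> Lin"
| Lin_comp: "f \<in> Lin \<Longrightarrow> g \<in> Lin \<Longrightarrow> f \<circ> g \<in> Lin"

end

theory Submission
  imports Defs
begin

text \<open>
  Write \<open>w x\<close> for the supremum of all \<open>y\<close> such that \<open>f x \<le> a\<close> implies \<open>f y \<le> a\<close> for every
  \<open>f \<in> Lin\<close>. Each \<open>f \<in> Lin\<close> preserves nonempty suprema, so \<open>w x\<close> itself belongs to that set;
  this makes \<open>w\<close> a closure operation fixing \<open>a\<close>. Precomposing \<open>f\<close> with a translation in each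
  argument in turn shows that \<open>w\<close> is a nucleus. Conversely, a nucleus \<open>c\<close> satisfies
  \<open>f (c x) \<le> c (f x)\<close> for \<open>f \<in> Lin\<close>, so if it fixes \<open>a\<close> then \<open>c x\<close> lies in the set defining
  \<open>w x\<close>.
\<close>

lemma Lin_mono:
  fixes f :: "'a::ordered_magma \<Rightarrow> 'a"
  assumes "f \<in> Lin"
  shows "mono f"
  using assms
proof induction
  case (Lin_comp f g)
  then show ?case by (simp add: mono_def)
qed (auto simp: mono_def left_translation_def right_translation_def intro: magma_mult_mono)

lemma Lin_Sup:
  fixes f :: "'a::near_prequantale \<Rightarrow> 'a"
  assumes "f \<in> Lin" and "X \<noteq> {}"
  shows "f (Sup X) = Sup (f ` X)"
  using assms
proof (induction arbitrary: X)
  case (Lin_left r)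
  then show ?case
    by (simp add: left_translation_def [abs_def] mult_nonempty_Sup)
next
  case (Lin_right r)
  then show ?case
    by (simp add: right_translation_def [abs_def] nonempty_Sup_mult)
next
  case (Lin_comp f g)
  then show ?case by (simp add: image_comp)
qed simp

text \<open>For a left translation, \<open>r * c x \<le> c r * c x \<le> c (r * x)\<close>; right
  translations are symmetric, and monotonicity of \<open>f\<close> handles compositions.\<close>

lemma Lin_nucleus_le:
  fixes c :: "'a::ordered_magma \<Rightarrow> 'a"
  assumes "f \<in> Lin" and c: "nucleus c"
  shows "f (c x) \<le> c (f x)"
proof -
  have exp: "y \<le> c y" and c_mult: "c y * c z \<le> c (y * z)" and mono: "mono c" for y z
    using c by (auto simp: nucleus_def closure_operation_def)
  from \<open>f \<in> Lin\<close> show ?thesis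
  proof (induction arbitrary: x)
    case Lin_id
    show ?case by simp
  next
    case (Lin_left r)
    show ?case
      unfolding left_translation_def
      by (rule order_trans [OF magma_mult_mono [OF exp order_refl] c_mult])
  next
    case (Lin_right r)
    show ?case
      unfolding right_translation_def
      by (rule order_trans [OF magma_mult_mono [OF order_refl exp] c_mult])
  next
    case (Lin_comp f g)
    have "f (g (c x)) \<le> f (c (g x))"
      by (rule monoD [OF Lin_mono [OF \<open>f \<in> Lin\<close>] Lin_comp.IH(2)])
    also have "\<dots> \<le> c (f (g x))"
      by (rule Lin_comp.IH(1))
    finally show ?case by simp
  qed
qed

text \<open>Membership of \<open>y\<close> in \<open>residual_set a x\<close> is a preorder between
  \<open>y\<close> and \<open>x\<close>: the syntactic preorder of the down-set of \<open>a\<close>,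
  with \<open>Lin\<close> as its contexts.\<close>

definition residual_set :: "'a::ordered_magma \<Rightarrow> 'a \<Rightarrow> 'a set" where
  "residual_set a x = {y. \<forall>f\<in>Lin. f x \<le> a \<longrightarrow> f y \<le> a}"

lemma residual_setD: "y \<in> residual_set a x \<Longrightarrow> f \<in> Lin \<Longrightarrow> f x \<le> a \<Longrightarrow> f y \<le> a"
  unfolding residual_set_def by blast

lemma residual_setI: "(\<And>f. f \<in> Lin \<Longrightarrow> f x \<le> a \<Longrightarrow> f y \<le> a) \<Longrightarrow> y \<in> residual_set a x"
  unfolding residual_set_def by blast

lemma residual_set_refl: "x \<in> residual_set a x"
  by (simp add: residual_set_def)

lemma residual_set_trans:
  "y \<in> residual_set a x \<Longrightarrow> z \<in> residual_set a y \<Longrightarrow> z \<in> residual_set a x"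
  by (rule residual_setI) (rule residual_setD [OF _ _ residual_setD])

lemma residual_set_le: "x \<le> y \<Longrightarrow> x \<in> residual_set a y"
  by (rule residual_setI) (rule order_trans [OF monoD [OF Lin_mono]])

lemma residual_set_mult:
  assumes x: "x' \<in> residual_set a x" and y: "y' \<in> residual_set a y"
  shows "x' * y' \<in> residual_set a (x * y)"
proof (rule residual_setI)
  fix f :: "'a \<Rightarrow> 'a"
  assume f: "f \<in> Lin" and "f (x * y) \<le> a"
  \<comment> \<open>The factors are exchanged one at a time: first \<open>y\<close> in the context
    \<open>f (x * _)\<close>, then \<open>x\<close> in the context
    \<open>f (_ * y')\<close>.\<close>
  then have "f (x * y') \<le> a"
    using residual_setD [OF y Lin.Lin_comp [OF f Lin.Lin_left]] by (simp add: left_translation_def)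
  then show "f (x' * y') \<le> a"
    using residual_setD [OF x Lin.Lin_comp [OF f Lin.Lin_right]] by (simp add: right_translation_def)
qed

lemma Sup_residual_set_upper:
  "y \<in> residual_set a x \<Longrightarrow> y \<le> Sup (residual_set a (x :: 'a::near_prequantale))"
  by (rule nonempty_Sup_upper)

text \<open>The supremum is thus a maximum, so that bounds on it reduce to membership in
  \<open>residual_set\<close>.\<close>

lemma Sup_residual_set_mem:
  fixes a :: "'a::near_prequantale"
  shows "Sup (residual_set a x) \<in> residual_set a x"
proof -
  have ne: "residual_set a x \<noteq> {}"
    using residual_set_refl by blast
  show ?thesis
  proof (rule residual_setI)
    fix f :: "'a \<Rightarrow> 'a"
    assume "f \<in> Lin" and "f x \<le> a"
    show "f (Sup (residual_set a x)) \<le> a"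
      unfolding Lin_Sup [OF \<open>f \<in> Lin\<close> ne]
    proof (rule nonempty_Sup_least)
      show "f ` residual_set a x \<noteq> {}"
        using ne by simp
      show "z \<le> a" if "z \<in> f ` residual_set a x" for z
        using that residual_setD [OF _ \<open>f \<in> Lin\<close> \<open>f x \<le> a\<close>] by blast
    qed
  qed
qed

text \<open>Each law reflects a property of the preorder: reflexivity, transitivity, extension of
  \<open>\<le>\<close>, or compatibility with multiplication.\<close>

lemma nucleus_Sup_residual_set:
  fixes a :: "'a::near_prequantale"
  shows "nucleus (\<lambda>x. Sup (residual_set a x))"
  unfolding nucleus_def closure_operation_def
proof (intro conjI allI monoI)
  fix x y :: 'a
  show "x \<le> Sup (residual_set a x)"
    by (rule Sup_residual_set_upper [OF residual_set_refl])
  show "Sup (residual_set a x) \<le> Sup (residual_set a y)" if "x \<le> y"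
    by (rule Sup_residual_set_upper
        [OF residual_set_trans [OF residual_set_le [OF that] Sup_residual_set_mem]])
  show "Sup (residual_set a (Sup (residual_set a x))) = Sup (residual_set a x)"
    by (intro order_antisym Sup_residual_set_upper residual_set_refl
        residual_set_trans [OF Sup_residual_set_mem Sup_residual_set_mem])
  show "Sup (residual_set a x) * Sup (residual_set a y) \<le> Sup (residual_set a (x * y))"
    by (intro Sup_residual_set_upper residual_set_mult Sup_residual_set_mem)
qed

lemma Sup_residual_set_self:
  fixes a :: "'a::near_prequantale"
  shows "Sup (residual_set a a) = a"
proof (rule order_antisym)
  show "Sup (residual_set a a) \<le> a"
    \<comment> \<open>The context \<open>id\<close> already forces every member of
      \<open>residual_set a a\<close> below \<open>a\<close>.\<close>
    using residual_setD [OF Sup_residual_set_mem Lin.Lin_id, of a a] by simp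
qed (rule Sup_residual_set_upper [OF residual_set_refl])

lemma nucleus_mem_residual_set:
  assumes "nucleus c" and "c a = a"
  shows "c x \<in> residual_set a x"
proof (rule residual_setI)
  fix f :: "'a \<Rightarrow> 'a"
  assume "f \<in> Lin" and "f x \<le> a"
  have "f (c x) \<le> c (f x)"
    by (rule Lin_nucleus_le [OF \<open>f \<in> Lin\<close> \<open>nucleus c\<close>])
  also have "\<dots> \<le> c a"
    using \<open>nucleus c\<close> \<open>f x \<le> a\<close> by (simp add: nucleus_def closure_operation_def monoD)
  finally show "f (c x) \<le> a"
    using \<open>c a = a\<close> by simp
qed

lemma nucleus_le_Sup_residual_set:
  fixes a :: "'a::near_prequantale"
  assumes "nucleus c" and "c a = a"
  shows "c \<le> (\<lambda>x. Sup (residual_set a x))"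
  by (intro le_funI Sup_residual_set_upper nucleus_mem_residual_set assms)

text \<open>The supremum map is itself a nucleus fixing \<open>a\<close> and dominates all others,
  which also shows that the greatest one in \<open>nucleus_v\<close> exists.\<close>

lemma nucleus_v_eq:
  fixes a :: "'a::near_prequantale"
  shows "nucleus_v a = (\<lambda>x. Sup (residual_set a x))"
  unfolding nucleus_v_def
  by (rule Greatest_equality)
    (auto simp: nucleus_Sup_residual_set Sup_residual_set_self intro: nucleus_le_Sup_residual_set)

theorem proposition5p11:
  fixes a :: "'a::near_prequantale"
  shows "(nucleus (nucleus_v a) \<and> nucleus_v a a = a \<and>
            (\<forall>c. nucleus c \<and> c a = a \<longrightarrow> c \<le> nucleus_v a)) \<and>
         (\<forall>x. nucleus_v a x = Sup {y. \<forall>f\<in>Lin. f x \<le> a \<longrightarrow> f y \<le> a}) \<and>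
         (\<forall>x. (\<forall>f\<in>Lin. f x \<le> a \<longrightarrow> f (nucleus_v a x) \<le> a) \<and>
              (\<forall>z. (\<forall>f\<in>Lin. f x \<le> a \<longrightarrow> f z \<le> a) \<longrightarrow> z \<le> nucleus_v a x))"
proof (intro conjI allI impI ballI)
  show "nucleus (nucleus_v a)"
    by (simp add: nucleus_v_eq nucleus_Sup_residual_set)
  show "nucleus_v a a = a"
    by (simp add: nucleus_v_eq Sup_residual_set_self)
  show "c \<le> nucleus_v a" if "nucleus c \<and> c a = a" for c
    using that by (simp add: nucleus_v_eq nucleus_le_Sup_residual_set)
next
  fix x
  show "nucleus_v a x = Sup {y. \<forall>f\<in>Lin. f x \<le> a \<longrightarrow> f y \<le> a}"
    by (simp add: nucleus_v_eq residual_set_def)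
  show "f (nucleus_v a x) \<le> a" if "f \<in> Lin" "f x \<le> a" for f
    unfolding nucleus_v_eq by (rule residual_setD [OF Sup_residual_set_mem that])
  show "z \<le> nucleus_v a x" if "\<forall>f\<in>Lin. f x \<le> a \<longrightarrow> f z \<le> a" for z
    unfolding nucleus_v_eq using that
    by (intro Sup_residual_set_upper) (unfold residual_set_def, rule CollectI)
qed

end
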